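(* Let $1\le p<\infty$, $t>-1$ and $f\in A_t^p(\mathcal{U})$. If $\mathcal{L}^{\alpha} f\equiv 0$ on $\mathcal{U}$ for some multi-index $\alpha\in\mathbb{N}_0^n$, then $f\equiv 0$.
   Context: Let $n$ be a positive integer. $\mathbb{N}_0$ denotes the nonnegative integers. Write $z=(z',z_n)\in\mathbb{C}^n$ with $z'=(z_1,\dots,z_{n-1})\in\mathbb{C}^{n-1}$, $z_n\in\mathbb{C}$. The Siegel upper half-space is $\mathcal{U}=\{z\in\mathbb{C}^n:\mathrm{Im}\,z_n>|z'|^2\}$, and $\rho(z)=\mathrm{Im}\,z_n-|z'|^2$ for $z\in\mathcal{U}$. For $1\le p<\infty$ and $t>-1$, $L_t^p(\mathcal{U})$ is the space of Lebesgue measurable $f$ on $\mathcal{U}$ with $\|f\|_{p,t}=\left(\int_{\mathcal{U}}|f(z)|^p\rho(z)^t\,dV(z)\right)^{1/p}<\infty$, where $dV$ is Lebesgue measure on $\mathbb{C}^n$. The weighted Bergman space $A_t^p(\mathcal{U})$ is the subspace of $L_t^p(\mathcal{U})$ consisting of holomorphic functions. Differential operators: $\mathcal{L}_j=\frac{\partial}{\partial z_j}+2i\bar z_j\frac{\partial}{\partial z_n}$ for $1\le j\le n-1$, $\mathcal{L}_n=\frac{\partial}{\partial z_n}$, and $\mathcal{L}^{\alpha}=(\mathcal{L}_1)^{\alpha_1}\cdots(\mathcal{L}_n)^{\alpha_n}$ for $\alpha\in\mathbb{N}_0^n$ (here $\partial/\partial z_j$ are the Wirtinger derivatives). *)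

theory Defs
  imports "HOL-Analysis.Analysis"
begin

text \<open>
  The space \<open>\<complex>\<^sup>n\<close> is \<open>complex ^ 'n\<close> with \<open>'n\<close> a finite linearly ordered index type, so that
  \<open>CARD('n)\<close> ranges over all positive integers and the indices \<open>1, \<dots>, n\<close> are the elements of \<open>'n\<close>
  in increasing order.  The case \<open>n = 1\<close> (where \<open>z'\<close> is empty) is included.
\<close>

definition last_index :: "'n::{finite,linorder}" where
  "last_index = Max UNIV"

definition siegel_rho :: "complex ^ 'n::{finite,linorder} \<Rightarrow> real" where
  "siegel_rho z = Im (z $ last_index) - (\<Sum>j\<in>UNIV - {last_index}. (cmod (z $ j))\<^sup>2)"

definition siegel :: "(complex ^ 'n::{finite,linorder}) set" where
  "siegel = {z. Im (z $ last_index) > (\<Sum>j\<in>UNIV - {last_index}. (cmod (z $ j))\<^sup>2)}"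

text \<open>
  Functions on a set are total functions whose values outside the set are irrelevant.
  Holomorphy in several variables (on an open set) is complex Frechet differentiability.
\<close>

definition holomorphic_vec_on ::
    "(complex ^ 'n \<Rightarrow> complex) \<Rightarrow> (complex ^ 'n) set \<Rightarrow> bool" where
  "holomorphic_vec_on f S \<longleftrightarrow>
     (\<forall>z\<in>S. \<exists>D. (f has_derivative D) (at z) \<and> (\<forall>c v. D (c *s v) = c * D v))"

text \<open>The norm \<open>\<parallel>f\<parallel>\<^bsub>p,t\<^esub>\<close> is finite iff its \<open>p\<close>-th power, the integral below, is.\<close>

definition weighted_Lp ::
    "real \<Rightarrow> real \<Rightarrow> (complex ^ 'n::{finite,linorder} \<Rightarrow> complex) set" where
  "weighted_Lp p t =
     {f \<in> borel_measurable (lebesgue_on siegel).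
        (\<integral>\<^sup>+ z. ennreal (cmod (f z) powr p * siegel_rho z powr t) \<partial>lebesgue_on siegel) < \<infinity>}"

definition weighted_bergman ::
    "real \<Rightarrow> real \<Rightarrow> (complex ^ 'n::{finite,linorder} \<Rightarrow> complex) set" where
  "weighted_bergman p t = {f \<in> weighted_Lp p t. holomorphic_vec_on f siegel}"

text \<open>
  The Wirtinger derivative \<open>\<partial>/\<partial>z\<^sub>j = (\<partial>/\<partial>x\<^sub>j - \<i> \<partial>/\<partial>y\<^sub>j)/2\<close>, for functions that are
  differentiable in the real sense; the functions \<open>siegel_L j f\<close> are in general not holomorphic.
\<close>

definition wirtinger ::
    "'n::finite \<Rightarrow> (complex ^ 'n \<Rightarrow> complex) \<Rightarrow> complex ^ 'n \<Rightarrow> complex" where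
  "wirtinger j g z =
     (vector_derivative (\<lambda>s::real. g (z + axis j (of_real s))) (at 0)
      - \<i> * vector_derivative (\<lambda>s::real. g (z + axis j (\<i> * of_real s))) (at 0)) / 2"

definition siegel_L ::
    "'n::{finite,linorder} \<Rightarrow> (complex ^ 'n::{finite,linorder} \<Rightarrow> complex) \<Rightarrow> complex ^ 'n::{finite,linorder} \<Rightarrow> complex" where
  "siegel_L j g z =
     (if j = last_index then wirtinger last_index g z
      else wirtinger j g z + 2 * \<i> * cnj (z $ j) * wirtinger last_index g z)"

text \<open>\<open>(\<L>\<^sub>1)\<^bsup>\<alpha>\<^sub>1\<^esup> \<cdots> (\<L>\<^sub>n)\<^bsup>\<alpha>\<^sub>n\<^esup>\<close>, the operator with the largest index being applied first.\<close>

definition siegel_L_pow ::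
    "('n::{finite,linorder} \<Rightarrow> nat) \<Rightarrow> (complex ^ 'n::{finite,linorder} \<Rightarrow> complex) \<Rightarrow> complex ^ 'n::{finite,linorder} \<Rightarrow> complex" where
  "siegel_L_pow \<alpha> f = foldr (\<lambda>j. siegel_L j ^^ \<alpha> j) (sorted_list_of_set UNIV) f"

end

theory Submission
  imports Defs "HOL-Complex_Analysis.Complex_Analysis"
    "HOL-Computational_Algebra.Fundamental_Theorem_Algebra"
begin

text \<open>
  The hypothesis involves the operators \<open>\<L>\<^sub>j\<close>, whose coefficients contain \<open>cnj (z $ j)\<close>.  Since
  \<open>\<partial>/\<partial>z\<^sub>j\<close> treats conjugate coordinates as constants, \<open>\<L>\<^sup>\<alpha> f\<close> is a polynomial in the conjugate
  coordinates whose coefficients are holomorphic functions.  Its part of top degree comes from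
  choosing the term \<open>2\<i> cnj (z $ j) \<partial>/\<partial>z\<^sub>n\<close> in every factor \<open>\<L>\<^sub>j\<close> with \<open>j \<noteq> n\<close>, so along the diagonal line
  \<open>z + \<zeta>(1,\<dots>,1)\<close> the highest power of \<open>cnj \<zeta>\<close> has, up to a nonzero constant, the coefficient
  \<open>(\<partial>/\<partial>z\<^sub>n)\<^bsup>\<bar>\<alpha>\<bar>\<^esup> f\<close>.  A polynomial in \<open>cnj \<zeta>\<close> with holomorphic coefficients that vanishes identically has
  vanishing top coefficient: on a circle \<open>\<bar>\<zeta>\<bar> = R\<close> one may replace \<open>cnj \<zeta>\<close> by \<open>R\<^sup>2/\<zeta>\<close>, and after
  multiplication by \<open>\<zeta>\<^sup>m\<close>, where \<open>m\<close> is the degree, this becomes a holomorphic function on the disc, whose value at \<open>0\<close> is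
  \<open>R\<^bsup>2m\<^esup>\<close> times the top coefficient.  Hence \<open>\<L>\<^sup>\<alpha> f = 0\<close> forces
  \<open>(\<partial>/\<partial>z\<^sub>n)\<^bsup>N\<^esup> f = 0\<close> for \<open>N = \<bar>\<alpha>\<bar>\<close> (\<open>conj_poly_siegel_L_pow\<close>, \<open>conj_poly_zero_imp_top_zero\<close>).

  Consequently \<open>f\<close> is a polynomial along every real line \<open>z + \<real> e\<^sub>n\<close>.  The domain, the weight and
  Lebesgue measure are all invariant under translations in this direction, so integrability
  implies that, for almost every \<open>z\<close>, the values \<open>f (z + k e\<^sub>n)\<close> tend to \<open>0\<close> as \<open>k\<close> runs through the
  natural numbers (\<open>AE_translates_tendsto_0\<close>).  A polynomial tending to \<open>0\<close> along the natural numbers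
  is \<open>0\<close>, thus \<open>f = 0\<close> almost everywhere, and everywhere by continuity.
\<close>

section \<open>Holomorphy along complex lines\<close>

text \<open>
  Continuity together with complex differentiability along complex lines is an equivalent form of
  holomorphy on open sets.  It is used here because its stability under directional differentiation
  needs nothing beyond one-variable complex analysis.
\<close>

definition line_holomorphic_on :: "(complex ^ 'n \<Rightarrow> complex) \<Rightarrow> (complex ^ 'n) set \<Rightarrow> bool" where
  "line_holomorphic_on f S \<longleftrightarrow> continuous_on S f \<and>
     (\<forall>z\<in>S. \<forall>v. (\<lambda>\<zeta>. f (z + \<zeta> *s v)) field_differentiable (at 0))"

definition line_deriv :: "complex ^ 'n \<Rightarrow> (complex ^ 'n \<Rightarrow> complex) \<Rightarrow> complex ^ 'n \<Rightarrow> complex" where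
  "line_deriv v f z = deriv (\<lambda>\<zeta>. f (z + \<zeta> *s v)) 0"

lemma continuous_on_vector_scalar_mult [continuous_intros]:
  fixes v :: "complex ^ 'n"
  assumes "continuous_on S g"
  shows "continuous_on S (\<lambda>x. g x *s v)"
  unfolding vector_scalar_mult_def by (intro continuous_intros assms)

lemma norm_vector_scalar_mult: "norm (c *s (v :: complex ^ 'n)) = cmod c * norm v"
  by (simp add: norm_vec_def norm_mult L2_set_right_distrib)

text \<open>
  Differentiability at the base point of a slice is differentiability at each of its points, because
  every point of a complex line may serve as base point.
\<close>

lemma line_holomorphic_has_field_derivative:
  assumes "line_holomorphic_on f S" "z + c *s v \<in> S"
  shows "((\<lambda>\<zeta>. f (z + \<zeta> *s v)) has_field_derivative line_deriv v f (z + c *s v)) (at c)"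
proof -
  have "(\<lambda>\<zeta>. f (z + c *s v + \<zeta> *s v)) field_differentiable (at 0)"
    using assms unfolding line_holomorphic_on_def by blast
  then have "((\<lambda>\<zeta>. f (z + c *s v + \<zeta> *s v)) has_field_derivative line_deriv v f (z + c *s v)) (at 0)"
    unfolding line_deriv_def using field_differentiable_derivI by blast
  moreover have "(\<lambda>\<zeta>. f (z + c *s v + \<zeta> *s v)) = (\<lambda>\<zeta>. f (z + (\<zeta> + c) *s v))"
    by (simp add: fun_eq_iff vector_sadd_rdistrib add_ac)
  ultimately show ?thesis
    using DERIV_shift[of "\<lambda>\<zeta>. f (z + \<zeta> *s v)" _ 0 c] by simp
qed

lemma line_holomorphic_on_slice:
  assumes "line_holomorphic_on f S" "\<And>\<zeta>. \<zeta> \<in> A \<Longrightarrow> z + \<zeta> *s v \<in> S"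
  shows "(\<lambda>\<zeta>. f (z + \<zeta> *s v)) holomorphic_on A"
  unfolding holomorphic_on_def
  using line_holomorphic_has_field_derivative[OF assms(1)] assms(2)
  by (meson field_differentiable_def has_field_derivative_at_within)

text \<open>
  Cauchy's integral formula on the slice.  The integrand depends on \<open>z\<close> only through \<open>f\<close>, so that
  continuity and holomorphy of the derivative are inherited from \<open>f\<close>.
\<close>

lemma line_deriv_eq_integral:
  assumes f: "line_holomorphic_on f S" and r: "0 < r"
    and S: "\<And>\<zeta>. cmod \<zeta> \<le> r \<Longrightarrow> z + \<zeta> *s v \<in> S"
  shows "line_deriv v f z =
    integral {0..1} (\<lambda>s. f (z + circlepath 0 r s *s v) / circlepath 0 r s)"
proof -
  define g where "g = (\<lambda>\<zeta>. f (z + \<zeta> *s v))"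
  have hol: "g holomorphic_on cball 0 r"
    unfolding g_def by (intro line_holomorphic_on_slice[OF f] S) auto
  have "(g has_field_derivative (1 / (2 * of_real pi * \<i>) *
      contour_integral (circlepath 0 r) (\<lambda>u. g u / (u - 0)^2))) (at 0)"
    using hol r
    by (intro Cauchy_derivative_integral_circlepath(2))
       (auto intro: holomorphic_on_imp_continuous_on holomorphic_on_subset)
  then have "line_deriv v f z =
      1 / (2 * of_real pi * \<i>) * contour_integral (circlepath 0 r) (\<lambda>u. g u / u^2)"
    unfolding line_deriv_def g_def by (simp add: DERIV_imp_deriv)
  also have "contour_integral (circlepath 0 r) (\<lambda>u. g u / u^2) =
      integral {0..1} (\<lambda>s. g (circlepath 0 r s) / circlepath 0 r s ^ 2 *
        vector_derivative (circlepath 0 r) (at s))"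
    by (simp add: contour_integral_integral)
  also have "\<dots> = integral {0..1} (\<lambda>s. (2 * of_real pi * \<i>) *
      (g (circlepath 0 r s) / circlepath 0 r s))"
  proof (rule integral_cong)
    fix s :: real
    have "vector_derivative (circlepath 0 r) (at s) = 2 * of_real pi * \<i> * circlepath 0 r s"
      by (simp only: vector_derivative_circlepath) (simp add: circlepath)
    moreover have "circlepath 0 r s \<noteq> 0" using r by (simp add: circlepath)
    ultimately show "g (circlepath 0 r s) / circlepath 0 r s ^ 2 *
        vector_derivative (circlepath 0 r) (at s) =
        (2 * of_real pi * \<i>) * (g (circlepath 0 r s) / circlepath 0 r s)"
      by (simp add: power2_eq_square)
  qed
  also have "\<dots> = (2 * of_real pi * \<i>) * integral {0..1} (\<lambda>s. g (circlepath 0 r s) / circlepath 0 r s)"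
    by (rule integral_mult_right)
  finally show ?thesis by (simp add: g_def)
qed

lemma open_slice_neighbourhood:
  fixes z v :: "complex ^ 'n"
  assumes "open S" "z \<in> S"
  obtains e r where "0 < e" "0 < r" "\<And>w \<zeta>. dist z w < e \<Longrightarrow> cmod \<zeta> \<le> r \<Longrightarrow> w + \<zeta> *s v \<in> S"
proof -
  obtain d where d: "d > 0" "ball z d \<subseteq> S" using assms openE by blast
  define r where "r = d / (2 * (norm v + 1))"
  have pos: "0 < 2 * (norm v + 1)" by (smt (verit) norm_ge_zero)
  show thesis
  proof (rule that[of "d / 2" r])
    show "0 < d / 2" "0 < r" using d pos by (auto simp: r_def)
    fix w and \<zeta> :: complex assume *: "dist z w < d / 2" "cmod \<zeta> \<le> r"
    have "cmod \<zeta> * norm v \<le> r * (norm v + 1)"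
      using * \<open>0 < r\<close> by (intro mult_mono) auto
    also have "\<dots> = d / 2" using pos by (simp add: r_def field_simps)
    finally have "norm (\<zeta> *s v) \<le> d / 2" by (simp add: norm_vector_scalar_mult)
    with * have "dist z (w + \<zeta> *s v) < d"
      using dist_triangle[of z "w + \<zeta> *s v" w] by (simp add: dist_norm)
    then show "w + \<zeta> *s v \<in> S" using d by auto
  qed
qed

lemma line_deriv_continuous_on:
  assumes f: "line_holomorphic_on f S" and S: "open S"
  shows "continuous_on S (line_deriv v f)"
proof -
  have "isCont (line_deriv v f) z" if "z \<in> S" for z
  proof -
    obtain e r where er: "0 < e" "0 < r" "\<And>w \<zeta>. dist z w < e \<Longrightarrow> cmod \<zeta> \<le> r \<Longrightarrow> w + \<zeta> *s v \<in> S"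
      using open_slice_neighbourhood[OF S \<open>z \<in> S\<close>] by blast
    have fS: "continuous_on S f" using f by (simp add: line_holomorphic_on_def)
    have c: "continuous_on (ball z e \<times> cbox 0 1)
        (\<lambda>(w, s). f (w + circlepath 0 r s *s v) / circlepath 0 r s)"
      unfolding split_beta circlepath using er
      by (intro continuous_intros continuous_on_compose2[OF fS]) (auto simp: norm_mult)
    have "continuous_on (ball z e)
        (\<lambda>w. integral (cbox 0 1) (\<lambda>s. f (w + circlepath 0 r s *s v) / circlepath 0 r s))"
      using integral_continuous_on_param[OF c] by simp
    moreover have "line_deriv v f w =
        integral (cbox 0 1) (\<lambda>s. f (w + circlepath 0 r s *s v) / circlepath 0 r s)"
      if "w \<in> ball z e" for w
      using line_deriv_eq_integral[OF f er(2)] er(3) that by simp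
    ultimately have "continuous_on (ball z e) (line_deriv v f)"
      by (metis (no_types, lifting) continuous_on_cong)
    then show ?thesis using er(1) by (simp add: continuous_on_eq_continuous_at)
  qed
  then show ?thesis by (simp add: continuous_at_imp_continuous_on)
qed

text \<open>
  Differentiate under the integral sign in the Cauchy formula.  The derivative of the integrand in the
  direction \<open>u\<close> is governed by \<open>line_deriv u f\<close>, which is already known to be continuous.
\<close>

lemma line_holomorphic_on_line_deriv:
  assumes f: "line_holomorphic_on f S" and S: "open S"
  shows "line_holomorphic_on (line_deriv v f) S"
  unfolding line_holomorphic_on_def
proof (intro conjI ballI allI line_deriv_continuous_on[OF assms])
  fix z u assume "z \<in> S"
  obtain e r where er: "0 < e" "0 < r" "\<And>w \<zeta>. dist z w < e \<Longrightarrow> cmod \<zeta> \<le> r \<Longrightarrow> w + \<zeta> *s v \<in> S"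
    using open_slice_neighbourhood[OF S \<open>z \<in> S\<close>] by blast
  \<comment> \<open>Moving by \<open>\<eta> u\<close> with \<open>\<bar>\<eta>\<bar> \<le> d\<close> keeps the base point in the ball in which the circles of radius \<open>r\<close>
    in direction \<open>v\<close> stay inside \<open>S\<close>.\<close>
  obtain e' d where d: "0 < e'" "0 < d"
      "\<And>w \<eta>. dist z w < e' \<Longrightarrow> cmod \<eta> \<le> d \<Longrightarrow> w + \<eta> *s u \<in> ball z e"
    using open_slice_neighbourhood[where S = "ball z e" and z = z and v = u] er(1) by auto
  have in_S: "z + \<eta> *s u + \<zeta> *s v \<in> S" if "cmod \<eta> < d" "cmod \<zeta> \<le> r" for \<eta> \<zeta>
    using d(1) d(3)[of z \<eta>] er(3)[of "z + \<eta> *s u" \<zeta>] that by simp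
  have swap: "z + \<eta> *s u + \<zeta> *s v = (z + \<zeta> *s v) + \<eta> *s u" for \<eta> \<zeta>
    by (simp add: add_ac)
  have circ: "cmod (circlepath 0 r s) = r" "circlepath 0 r s \<noteq> 0" for s
    using er(2) by (auto simp: circlepath norm_mult)
  have cont_circ: "continuous_on A (circlepath 0 r)" for A
    unfolding circlepath by (intro continuous_intros)
  have fS: "continuous_on S f" using f by (simp add: line_holomorphic_on_def)
  have "(\<lambda>\<eta>. integral (cbox 0 1)
      (\<lambda>s. f (z + \<eta> *s u + circlepath 0 r s *s v) / circlepath 0 r s)) holomorphic_on ball 0 d"
  proof (rule leibniz_rule_holomorphic)
    fix \<eta> :: complex and s :: real assume "\<eta> \<in> ball 0 d"
    then have "((\<lambda>\<eta>. f (z + circlepath 0 r s *s v + \<eta> *s u)) has_field_derivative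
        line_deriv u f (z + circlepath 0 r s *s v + \<eta> *s u)) (at \<eta>)"
      using in_S[of \<eta> "circlepath 0 r s"] circ
      by (intro line_holomorphic_has_field_derivative[OF f]) (simp add: swap)
    then show "((\<lambda>\<eta>. f (z + \<eta> *s u + circlepath 0 r s *s v) / circlepath 0 r s) has_field_derivative
        line_deriv u f (z + \<eta> *s u + circlepath 0 r s *s v) / circlepath 0 r s) (at \<eta> within ball 0 d)"
      unfolding swap[of _ "circlepath 0 r s", symmetric]
      by (rule has_field_derivative_at_within[OF DERIV_cdivide])
  next
    fix \<eta> :: complex assume "\<eta> \<in> ball 0 d"
    then show "(\<lambda>s. f (z + \<eta> *s u + circlepath 0 r s *s v) / circlepath 0 r s) integrable_on cbox 0 1"
      using in_S circ
      by (intro integrable_continuous continuous_intros continuous_on_compose2[OF fS] cont_circ) auto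
  next
    have "continuous_on (ball 0 d \<times> cbox 0 1)
        (\<lambda>x. line_deriv u f (z + fst x *s u + circlepath 0 r (snd x) *s v))"
      using in_S circ unfolding circlepath
      by (intro continuous_on_compose2[OF line_deriv_continuous_on[OF f S, of u]] continuous_intros) auto
    then show "continuous_on (ball 0 d \<times> cbox 0 1)
        (\<lambda>(\<eta>, s). line_deriv u f (z + \<eta> *s u + circlepath 0 r s *s v) / circlepath 0 r s)"
      unfolding split_beta using circ
      by (intro continuous_intros continuous_on_compose2[OF cont_circ]) auto
  qed auto
  moreover have "integral (cbox 0 1)
      (\<lambda>s. f (z + \<eta> *s u + circlepath 0 r s *s v) / circlepath 0 r s) = line_deriv v f (z + \<eta> *s u)"
    if "\<eta> \<in> ball 0 d" for \<eta>
    using line_deriv_eq_integral[OF f er(2), of "z + \<eta> *s u" v] in_S that by simp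
  ultimately have "(\<lambda>\<eta>. line_deriv v f (z + \<eta> *s u)) holomorphic_on ball 0 d"
    by (rule holomorphic_transform)
  then show "(\<lambda>\<eta>. line_deriv v f (z + \<eta> *s u)) field_differentiable (at 0)"
    using d(2) by (simp add: holomorphic_on_imp_differentiable_at)
qed

lemma holomorphic_vec_imp_line_holomorphic:
  fixes f :: "complex ^ 'n \<Rightarrow> complex"
  assumes "holomorphic_vec_on f S"
  shows "line_holomorphic_on f S"
  unfolding line_holomorphic_on_def
proof (intro conjI ballI allI)
  show "continuous_on S f"
    using assms unfolding holomorphic_vec_on_def
    by (meson continuous_at_imp_continuous_on has_derivative_continuous)
next
  fix z v :: "complex ^ 'n" assume "z \<in> S"
  then obtain D where D: "(f has_derivative D) (at z)" "\<And>c v. D (c *s v) = c * D v"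
    using assms unfolding holomorphic_vec_on_def by blast
  have "linear (\<lambda>\<zeta>. \<zeta> *s v)"
    by (intro linearI) (auto simp: vec_eq_iff algebra_simps)
  then have "((\<lambda>\<zeta>. z + \<zeta> *s v) has_derivative (\<lambda>\<zeta>. 0 + \<zeta> *s v)) (at 0)"
    by (intro has_derivative_add has_derivative_const linear_imp_has_derivative)
  moreover have "(f has_derivative D) (at (z + 0 *s v))" using D by simp
  ultimately have "((\<lambda>\<zeta>. f (z + \<zeta> *s v)) has_derivative (\<lambda>\<zeta>. D (0 + \<zeta> *s v))) (at 0)"
    by (rule has_derivative_compose)
  moreover have "(\<lambda>\<zeta>. D (0 + \<zeta> *s v)) = (*) (D v)"
    by (simp add: fun_eq_iff D(2))
  ultimately have "((\<lambda>\<zeta>. f (z + \<zeta> *s v)) has_field_derivative D v) (at 0)"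
    by (simp add: has_field_derivative_def)
  then show "(\<lambda>\<zeta>. f (z + \<zeta> *s v)) field_differentiable (at 0)"
    using field_differentiable_def by blast
qed

lemma line_holomorphic_on_cong:
  assumes S: "open S" and eq: "\<And>z. z \<in> S \<Longrightarrow> g z = g' z" and g: "line_holomorphic_on g S"
  shows "line_holomorphic_on g' S"
  unfolding line_holomorphic_on_def
proof (intro conjI ballI allI)
  show "continuous_on S g'"
    using g eq unfolding line_holomorphic_on_def by (metis continuous_on_cong)
  fix z v assume z: "z \<in> S"
  obtain e r where r: "0 < e" "0 < r" "\<And>w \<zeta>. dist z w < e \<Longrightarrow> cmod \<zeta> \<le> r \<Longrightarrow> w + \<zeta> *s v \<in> S"
    using open_slice_neighbourhood[OF S z] by blast
  have "(\<lambda>\<zeta>. g (z + \<zeta> *s v)) field_differentiable (at 0)"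
    using g z unfolding line_holomorphic_on_def by blast
  then show "(\<lambda>\<zeta>. g' (z + \<zeta> *s v)) field_differentiable (at 0)"
    by (rule field_differentiable_transform_within[OF r(2), rotated 2]) (use r in \<open>auto intro!: eq\<close>)
qed

lemma line_holomorphic_on_add:
  assumes "line_holomorphic_on g S" "line_holomorphic_on g' S"
  shows "line_holomorphic_on (\<lambda>z. g z + g' z) S"
  using assms unfolding line_holomorphic_on_def
  by (auto intro!: continuous_intros field_differentiable_add)

lemma line_holomorphic_on_cmult:
  assumes "line_holomorphic_on g S"
  shows "line_holomorphic_on (\<lambda>z. c * g z) S"
  using assms unfolding line_holomorphic_on_def
  by (auto intro!: continuous_intros field_differentiable_mult)

section \<open>Wirtinger derivatives\<close>

text \<open>
  The numbers \<open>d\<close> and \<open>e\<close> are the values of \<open>\<partial>g/\<partial>z\<^sub>j\<close> and \<open>\<partial>g/\<partial>\<bar>z\<^sub>j\<close>: the derivative along the real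
  axis is \<open>d + e\<close> and the one along the imaginary axis is \<open>\<i> (d - e)\<close>.  Both are recorded because the
  product rule must be available for functions that are not holomorphic.
\<close>

definition has_wirtinger_derivs ::
    "'n::finite \<Rightarrow> (complex ^ 'n \<Rightarrow> complex) \<Rightarrow> complex ^ 'n \<Rightarrow> complex \<Rightarrow> complex \<Rightarrow> bool" where
  "has_wirtinger_derivs j g z d e \<longleftrightarrow>
     ((\<lambda>s::real. g (z + axis j (of_real s))) has_vector_derivative (d + e)) (at 0) \<and>
     ((\<lambda>s::real. g (z + axis j (\<i> * of_real s))) has_vector_derivative (\<i> * (d - e))) (at 0)"

lemma wirtinger_eq:
  assumes "has_wirtinger_derivs j g z d e"
  shows "wirtinger j g z = d"
  using assms unfolding has_wirtinger_derivs_def wirtinger_def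
  by (auto simp: vector_derivative_at)

lemma has_wirtinger_derivs_add:
  assumes "has_wirtinger_derivs j g z d e" "has_wirtinger_derivs j g' z d' e'"
  shows "has_wirtinger_derivs j (\<lambda>z. g z + g' z) z (d + d') (e + e')"
  using assms unfolding has_wirtinger_derivs_def
  by (auto intro: has_vector_derivative_eq_rhs[OF has_vector_derivative_add] simp: algebra_simps)

lemma axis_zero: "axis j 0 = (0 :: complex ^ 'n)"
  by (simp add: vec_eq_iff axis_def)

lemma has_wirtinger_derivs_mult:
  assumes "has_wirtinger_derivs j g z d e" "has_wirtinger_derivs j g' z d' e'"
  shows "has_wirtinger_derivs j (\<lambda>z. g z * g' z) z (d * g' z + g z * d') (e * g' z + g z * e')"
  using assms unfolding has_wirtinger_derivs_def
  by (auto intro!: has_vector_derivative_eq_rhs[OF has_vector_derivative_mult]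
      simp: axis_zero algebra_simps)

lemma has_wirtinger_derivs_const: "has_wirtinger_derivs j (\<lambda>z. c) z 0 0"
  by (simp add: has_wirtinger_derivs_def)

lemma has_wirtinger_derivs_cnj:
  "has_wirtinger_derivs j (\<lambda>z. cnj (z $ k)) z 0 (if j = k then 1 else 0)"
proof -
  have "((\<lambda>s::real. cnj (z $ k + (if k = j then a * of_real s else (0::complex)))) has_vector_derivative
      (if j = k then cnj a else 0)) (at 0)" for a
    by (cases "j = k") (auto intro!: derivative_eq_intros)
  from this[of 1] this[of \<i>] show ?thesis
    unfolding has_wirtinger_derivs_def axis_def by auto
qed

lemma axis_eq_scalar_mult: "axis j c = c *s axis j (1 :: complex)"
  by (simp add: vec_eq_iff axis_def)

lemma has_wirtinger_derivs_cong:
  assumes "open S" "z \<in> S" "\<And>w. w \<in> S \<Longrightarrow> g w = g' w" "has_wirtinger_derivs j g z d e"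
  shows "has_wirtinger_derivs j g' z d e"
proof -
  have "((\<lambda>s::real. g' (z + axis j (c * of_real s))) has_vector_derivative D) (at 0)"
    if "((\<lambda>s::real. g (z + axis j (c * of_real s))) has_vector_derivative D) (at 0)" for c D
  proof (rule has_vector_derivative_transform_within_open[OF that])
    have "continuous_on UNIV (\<lambda>s::real. z + axis j (c * of_real s))"
      unfolding axis_eq_scalar_mult[of j "c * _"] by (intro continuous_intros)
    then show "open ((\<lambda>s::real. z + axis j (c * of_real s)) -` S)"
      using assms(1) by (rule open_vimage[rotated])
    show "0 \<in> (\<lambda>s::real. z + axis j (c * of_real s)) -` S"
      using assms(2) by (simp add: axis_zero)
  qed (use assms(3) in auto)
  from this[of 1] this[of \<i>] show ?thesis
    using assms(4) unfolding has_wirtinger_derivs_def by auto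
qed

text \<open>
  The Cauchy-Riemann equation in the variable \<open>z\<^sub>j\<close>.
\<close>

lemma line_holomorphic_has_wirtinger_derivs:
  assumes "line_holomorphic_on h S" "z \<in> S"
  shows "has_wirtinger_derivs j h z (line_deriv (axis j 1) h z) 0"
proof -
  define d where "d = line_deriv (axis j 1) h z"
  have d: "((\<lambda>\<zeta>. h (z + \<zeta> *s axis j 1)) has_field_derivative d) (at 0)"
    using line_holomorphic_has_field_derivative[OF assms(1), of z 0 "axis j 1"] assms(2) by (simp add: d_def)
  have "((\<lambda>s::real. h (z + axis j (a * of_real s))) has_vector_derivative a * d) (at 0)" for a
  proof -
    have "((\<lambda>\<zeta>. h (z + (a * \<zeta>) *s axis j 1)) has_field_derivative d * a) (at 0)"
      by (rule DERIV_chain2[of "\<lambda>\<zeta>. h (z + \<zeta> *s axis j 1)"]) (use d in \<open>auto intro!: derivative_eq_intros\<close>)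
    then have "((\<lambda>s::real. h (z + (a * of_real s) *s axis j 1)) has_vector_derivative d * a) (at 0)"
      using has_vector_derivative_real_field[of "\<lambda>\<zeta>. h (z + (a * \<zeta>) *s axis j 1)" _ 0] by simp
    then show ?thesis by (simp add: mult.commute[of a d] flip: axis_eq_scalar_mult)
  qed
  from this[of 1] this[of \<i>] show ?thesis
    by (simp add: has_wirtinger_derivs_def d_def)
qed

lemma wirtinger_line_holomorphic:
  assumes "line_holomorphic_on h S" "z \<in> S"
  shows "wirtinger j h z = line_deriv (axis j 1) h z"
  using wirtinger_eq[OF line_holomorphic_has_wirtinger_derivs[OF assms]] .

lemma line_holomorphic_on_wirtinger:
  assumes "line_holomorphic_on h S" "open S"
  shows "line_holomorphic_on (wirtinger j h) S"
  using wirtinger_line_holomorphic[OF assms(1)]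
  by (intro line_holomorphic_on_cong[OF assms(2) _ line_holomorphic_on_line_deriv[OF assms]]) simp

lemma line_holomorphic_on_wirtinger_funpow:
  assumes "line_holomorphic_on h S" "open S"
  shows "line_holomorphic_on ((wirtinger j ^^ N) h) S"
  by (induction N) (auto intro: assms line_holomorphic_on_wirtinger)

section \<open>Polynomials in the conjugate coordinates\<close>

text \<open>
  Functions \<open>g\<close> that are polynomials of degree at most \<open>m\<close> in the conjugate coordinates with
  holomorphic coefficients.  The function \<open>q\<close> is the sum of the coefficients of the terms of degree
  exactly \<open>m\<close>, that is, the coefficient of \<open>(cnj \<zeta>)\<^sup>m\<close> after the substitution of \<open>z + \<zeta>(1,\<dots>,1)\<close> in the
  conjugated variables only.  As only this leading part is of interest, no normal form of \<open>g\<close> is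
  recorded, and \<open>q\<close> is generated together with \<open>g\<close>.
\<close>

inductive conj_poly ::
    "(complex ^ 'n) set \<Rightarrow> nat \<Rightarrow> (complex ^ 'n \<Rightarrow> complex) \<Rightarrow> (complex ^ 'n \<Rightarrow> complex) \<Rightarrow> bool"
  for S where
  holo: "line_holomorphic_on h S \<Longrightarrow> conj_poly S 0 h h"
| conj: "conj_poly S m g q \<Longrightarrow> conj_poly S (Suc m) (\<lambda>z. c * cnj (z $ k) * g z) (\<lambda>z. c * q z)"
| raise: "conj_poly S m g q \<Longrightarrow> conj_poly S (Suc m) g (\<lambda>_. 0)"
| add: "conj_poly S m g q \<Longrightarrow> conj_poly S m g' q' \<Longrightarrow>
    conj_poly S m (\<lambda>z. g z + g' z) (\<lambda>z. q z + q' z)"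
| cong: "conj_poly S m g q \<Longrightarrow> (\<And>z. z \<in> S \<Longrightarrow> g z = g' z) \<Longrightarrow> (\<And>z. z \<in> S \<Longrightarrow> q z = q' z) \<Longrightarrow>
    conj_poly S m g' q'"

lemma conj_poly_top_line_holomorphic:
  assumes "conj_poly S m g q" "open S"
  shows "line_holomorphic_on q S"
  using assms
proof (induction rule: conj_poly.induct)
  case (raise m g q)
  then show ?case
    by (simp add: line_holomorphic_on_def)
next
  case (cong m g q g' q')
  then show ?case using line_holomorphic_on_cong[of S q q'] by blast
qed (auto intro: line_holomorphic_on_add line_holomorphic_on_cmult)

lemma has_wirtinger_derivs_conj_mult:
  assumes "has_wirtinger_derivs j g z d e"
  shows "\<exists>e'. has_wirtinger_derivs j (\<lambda>z. c * cnj (z $ k) * g z) z (c * cnj (z $ k) * d) e'"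
  using has_wirtinger_derivs_mult[OF has_wirtinger_derivs_mult[OF has_wirtinger_derivs_const
        has_wirtinger_derivs_cnj] assms, of c k] by auto

lemma conj_poly_has_wirtinger_derivs:
  assumes "conj_poly S m g q" "open S" "z \<in> S"
  shows "\<exists>d e. has_wirtinger_derivs j g z d e"
  using assms
proof (induction rule: conj_poly.induct)
  case holo
  then show ?case using line_holomorphic_has_wirtinger_derivs by blast
next
  case conj
  then show ?case using has_wirtinger_derivs_conj_mult by blast
next
  case add
  then show ?case using has_wirtinger_derivs_add by blast
next
  case (cong m g q g' q')
  then show ?case using has_wirtinger_derivs_cong[of S z g g'] by blast
qed auto

lemma wirtinger_cong:
  assumes "conj_poly S m g q" "open S" "z \<in> S" "\<And>w. w \<in> S \<Longrightarrow> g w = g' w"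
  shows "wirtinger j g z = wirtinger j g' z"
proof -
  obtain d e where g: "has_wirtinger_derivs j g z d e"
    using conj_poly_has_wirtinger_derivs[OF assms(1-3)] by blast
  from wirtinger_eq[OF g] wirtinger_eq[OF has_wirtinger_derivs_cong[OF assms(2-4) g]]
  show ?thesis by simp
qed

lemma wirtinger_add:
  assumes "conj_poly S m g q" "conj_poly S m' g' q'" "open S" "z \<in> S"
  shows "wirtinger j (\<lambda>z. g z + g' z) z = wirtinger j g z + wirtinger j g' z"
proof -
  obtain d e where g: "has_wirtinger_derivs j g z d e"
    using conj_poly_has_wirtinger_derivs[OF assms(1,3,4)] by blast
  obtain d' e' where g': "has_wirtinger_derivs j g' z d' e'"
    using conj_poly_has_wirtinger_derivs[OF assms(2-4)] by blast
  from wirtinger_eq[OF g] wirtinger_eq[OF g'] wirtinger_eq[OF has_wirtinger_derivs_add[OF g g']]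
  show ?thesis by simp
qed

lemma wirtinger_conj_mult:
  assumes "conj_poly S m g q" "open S" "z \<in> S"
  shows "wirtinger j (\<lambda>z. c * cnj (z $ k) * g z) z = c * cnj (z $ k) * wirtinger j g z"
proof -
  obtain d e where g: "has_wirtinger_derivs j g z d e"
    using conj_poly_has_wirtinger_derivs[OF assms] by blast
  obtain e' where "has_wirtinger_derivs j (\<lambda>z. c * cnj (z $ k) * g z) z (c * cnj (z $ k) * d) e'"
    using has_wirtinger_derivs_conj_mult[OF g] by blast
  from wirtinger_eq[OF g] wirtinger_eq[OF this] show ?thesis by simp
qed

lemma wirtinger_cmult:
  assumes "line_holomorphic_on g S" "z \<in> S"
  shows "wirtinger j (\<lambda>z. c * g z) z = c * wirtinger j g z"
  using wirtinger_eq[OF has_wirtinger_derivs_mult[OF has_wirtinger_derivs_const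
      line_holomorphic_has_wirtinger_derivs[OF assms]], of j c] wirtinger_line_holomorphic[OF assms]
  by simp

text \<open>
  The conjugate coordinates are constants for \<open>\<partial>/\<partial>z\<^sub>j\<close>, hence the derivative acts on the coefficients,
  the leading ones included.
\<close>

lemma conj_poly_wirtinger:
  assumes "conj_poly S m g q" "open S"
  shows "conj_poly S m (wirtinger j g) (wirtinger j q)"
  using assms
proof (induction rule: conj_poly.induct)
  case (holo h)
  then show ?case by (intro conj_poly.holo line_holomorphic_on_wirtinger)
next
  case (conj m g q c k)
  show ?case
  proof (rule conj_poly.cong[OF conj_poly.conj[OF conj.IH[OF conj.prems]]])
    show "c * cnj (z $ k) * wirtinger j g z = wirtinger j (\<lambda>z. c * cnj (z $ k) * g z) z"
      if "z \<in> S" for z using wirtinger_conj_mult[OF conj.hyps conj.prems that] by simp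
    show "c * wirtinger j q z = wirtinger j (\<lambda>z. c * q z) z" if "z \<in> S" for z
      using wirtinger_cmult[OF conj_poly_top_line_holomorphic[OF conj.hyps conj.prems] that] by simp
  qed
next
  case (raise m g q)
  have "wirtinger j (\<lambda>_. 0) z = 0" for z :: "complex ^ 'a"
    by (rule wirtinger_eq[OF has_wirtinger_derivs_const])
  then show ?case by (intro conj_poly.cong[OF conj_poly.raise[OF raise.IH[OF raise.prems]]]) auto
next
  case (add m g q g' q')
  note top = conj_poly_top_line_holomorphic[OF add.hyps(1) add.prems]
    conj_poly_top_line_holomorphic[OF add.hyps(2) add.prems]
  show ?case
    by (rule conj_poly.cong[OF conj_poly.add[OF add.IH[OF add.prems]]])
       (simp_all add: wirtinger_add[OF add.hyps add.prems]
         wirtinger_add[OF conj_poly.holo[OF top(1)] conj_poly.holo[OF top(2)] add.prems])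
next
  case (cong m g q g' q')
  note top = conj_poly_top_line_holomorphic[OF cong.hyps(1) cong.prems]
  show ?case
    by (rule conj_poly.cong[OF cong.IH[OF cong.prems]])
       (rule wirtinger_cong[OF cong.hyps(1) cong.prems _ cong.hyps(2)]
         wirtinger_cong[OF conj_poly.holo[OF top] cong.prems _ cong.hyps(3)], assumption+)+
qed

text \<open>
  For \<open>j\<close> below the last index the summand \<open>\<partial>/\<partial>z\<^sub>j\<close> leaves the degree unchanged, and the summand
  \<open>2\<i> cnj (z $ j) \<partial>/\<partial>z\<^sub>n\<close> raises it, so that it alone determines the new leading part.
\<close>

lemma conj_poly_siegel_L:
  assumes g: "conj_poly S m g q" and S: "open S"
  shows "\<exists>m' c. c \<noteq> 0 \<and> conj_poly S m' (siegel_L j g) (\<lambda>z. c * wirtinger last_index q z)"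
proof (cases "j = last_index")
  case True
  have "conj_poly S m (siegel_L j g) (\<lambda>z. 1 * wirtinger last_index q z)"
    by (rule conj_poly.cong[OF conj_poly_wirtinger[OF assms]]) (auto simp: siegel_L_def True)
  then show ?thesis by (intro exI[of _ m] exI[of _ 1]) simp
next
  case False
  have "conj_poly S (Suc m) (siegel_L j g) (\<lambda>z. 2 * \<i> * wirtinger last_index q z)"
    by (rule conj_poly.cong[OF conj_poly.add[OF conj_poly.raise conj_poly.conj,
            OF conj_poly_wirtinger[OF assms] conj_poly_wirtinger[OF assms]]])
       (auto simp: siegel_L_def False)
  then show ?thesis by (intro exI[of _ "Suc m"] exI[of _ "2 * \<i>"]) simp
qed

lemma conj_poly_siegel_L_pow:
  assumes f: "line_holomorphic_on f S" and S: "open S"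
  shows "\<exists>m c N. c \<noteq> 0 \<and>
    conj_poly S m (siegel_L_pow \<alpha> f) (\<lambda>z. c * (wirtinger last_index ^^ N) f z)"
proof -
  define P where "P = (\<lambda>g. \<exists>m c N. c \<noteq> 0 \<and> conj_poly S m g (\<lambda>z. c * (wirtinger last_index ^^ N) f z))"
  have step: "P (siegel_L j g)" if "P g" for j g
  proof -
    obtain m c N where c: "c \<noteq> 0" "conj_poly S m g (\<lambda>z. c * (wirtinger last_index ^^ N) f z)"
      using \<open>P g\<close> unfolding P_def by (elim exE conjE) (rule that)
    obtain m' c' where c': "c' \<noteq> 0" "conj_poly S m' (siegel_L j g)
        (\<lambda>z. c' * wirtinger last_index (\<lambda>z. c * (wirtinger last_index ^^ N) f z) z)"
      using conj_poly_siegel_L[OF c(2) S, of j] by (elim exE conjE) (rule that)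
    have "conj_poly S m' (siegel_L j g) (\<lambda>z. (c' * c) * (wirtinger last_index ^^ Suc N) f z)"
      by (rule conj_poly.cong[OF c'(2)])
         (auto simp: wirtinger_cmult[OF line_holomorphic_on_wirtinger_funpow[OF f S]])
    moreover have "c' * c \<noteq> 0" using c c' by simp
    ultimately show ?thesis unfolding P_def by (intro exI conjI)
  qed
  have pow: "P ((siegel_L j ^^ k) g)" if "P g" for j k g
    using that by (induction k) (auto intro: step)
  have "conj_poly S 0 f (\<lambda>z. 1 * (wirtinger last_index ^^ 0) f z)"
    using conj_poly.holo[OF f] by simp
  then have "P f" unfolding P_def by (intro exI conjI) (rule one_neq_zero)
  then have "P (foldr (\<lambda>j. siegel_L j ^^ \<alpha> j) js f)" for js
    by (induction js) (auto intro: pow)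
  then show ?thesis unfolding siegel_L_pow_def P_def .
qed

text \<open>
  On the circle \<open>\<bar>\<zeta>\<bar> = R\<close> one has \<open>cnj \<zeta> = R\<^sup>2 / \<zeta>\<close>, and each of the at most \<open>m\<close> factors
  \<open>cnj (z $ k + \<zeta>)\<close>, multiplied by \<open>\<zeta>\<close>, becomes the polynomial \<open>cnj (z $ k) \<zeta> + R\<^sup>2\<close> with value \<open>R\<^sup>2\<close> at
  \<open>0\<close>.  A term of degree below \<open>m\<close> keeps a spare factor \<open>\<zeta>\<close> and contributes nothing at \<open>0\<close>.
\<close>

lemma conj_poly_circle:
  assumes "conj_poly S m g q" and R: "\<And>\<zeta>. cmod \<zeta> \<le> R \<Longrightarrow> z + \<zeta> *s 1 \<in> S" "0 \<le> R"
  shows "\<exists>G. G holomorphic_on cball 0 R \<and> G 0 = of_real R ^ (2 * m) * q z \<and>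
    (\<forall>\<zeta>. cmod \<zeta> = R \<longrightarrow> G \<zeta> = \<zeta> ^ m * g (z + \<zeta> *s 1))"
  using assms(1)
proof (induction rule: conj_poly.induct)
  case (holo h)
  then show ?case
    using line_holomorphic_on_slice[OF holo, of "cball 0 R" z 1] R
    by (intro exI[of _ "\<lambda>\<zeta>. h (z + \<zeta> *s 1)"]) simp
next
  case (conj m g q c k)
  then obtain G where G: "G holomorphic_on cball 0 R" "G 0 = of_real R ^ (2 * m) * q z"
    "\<And>\<zeta>. cmod \<zeta> = R \<Longrightarrow> G \<zeta> = \<zeta> ^ m * g (z + \<zeta> *s 1)" by blast
  show ?case
  proof (intro exI[of _ "\<lambda>\<zeta>. c * (cnj (z $ k) * \<zeta> + of_real R ^ 2) * G \<zeta>"] conjI allI impI)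
    show "(\<lambda>\<zeta>. c * (cnj (z $ k) * \<zeta> + of_real R ^ 2) * G \<zeta>) holomorphic_on cball 0 R"
      by (intro holomorphic_intros G)
    show "c * (cnj (z $ k) * 0 + of_real R ^ 2) * G 0 = of_real R ^ (2 * Suc m) * (c * q z)"
      by (simp add: G power2_eq_square)
    fix \<zeta> assume \<zeta>: "cmod \<zeta> = R"
    then have "of_real R ^ 2 = \<zeta> * cnj \<zeta>"
      using complex_norm_square[of \<zeta>] by simp
    then show "c * (cnj (z $ k) * \<zeta> + of_real R ^ 2) * G \<zeta> =
        \<zeta> ^ Suc m * (c * cnj ((z + \<zeta> *s 1) $ k) * g (z + \<zeta> *s 1))"
      by (simp add: G(3)[OF \<zeta>] algebra_simps)
  qed
next
  case (raise m g q)
  then obtain G where G: "G holomorphic_on cball 0 R" "G 0 = of_real R ^ (2 * m) * q z"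
    "\<And>\<zeta>. cmod \<zeta> = R \<Longrightarrow> G \<zeta> = \<zeta> ^ m * g (z + \<zeta> *s 1)" by blast
  have "(\<lambda>\<zeta>. \<zeta> * G \<zeta>) holomorphic_on cball 0 R"
    by (intro holomorphic_intros G)
  then show ?case
    by (intro exI[of _ "\<lambda>\<zeta>. \<zeta> * G \<zeta>"]) (simp add: G(3))
next
  case (add m g q g' q')
  then obtain G G' where G: "G holomorphic_on cball 0 R" "G 0 = of_real R ^ (2 * m) * q z"
    "\<And>\<zeta>. cmod \<zeta> = R \<Longrightarrow> G \<zeta> = \<zeta> ^ m * g (z + \<zeta> *s 1)"
    and G': "G' holomorphic_on cball 0 R" "G' 0 = of_real R ^ (2 * m) * q' z"
    "\<And>\<zeta>. cmod \<zeta> = R \<Longrightarrow> G' \<zeta> = \<zeta> ^ m * g' (z + \<zeta> *s 1)" by blast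
  have "(\<lambda>\<zeta>. G \<zeta> + G' \<zeta>) holomorphic_on cball 0 R"
    by (intro holomorphic_intros G G')
  then show ?case
    by (intro exI[of _ "\<lambda>\<zeta>. G \<zeta> + G' \<zeta>"]) (simp add: G(2,3) G'(2,3) distrib_left)
next
  case (cong m g q g' q')
  have "z \<in> S" using R(1)[of 0] R(2) by simp
  with cong.IH show ?case by (simp add: cong.hyps(2,3) R)
qed

text \<open>
  The holomorphic function from \<open>conj_poly_circle\<close> vanishes on a circle, and so at its centre
  by the maximum principle.
\<close>

lemma conj_poly_zero_imp_top_zero:
  assumes "conj_poly S m g q" "open S" "\<And>z. z \<in> S \<Longrightarrow> g z = 0" "z \<in> S"
  shows "q z = 0"
proof -
  obtain e R where R: "0 < e" "0 < R" "\<And>w \<zeta>. dist z w < e \<Longrightarrow> cmod \<zeta> \<le> R \<Longrightarrow> w + \<zeta> *s 1 \<in> S"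
    using open_slice_neighbourhood[OF assms(2,4)] by blast
  then have R': "z + \<zeta> *s 1 \<in> S" if "cmod \<zeta> \<le> R" for \<zeta> using that by simp
  obtain G where G: "G holomorphic_on cball 0 R" "G 0 = of_real R ^ (2 * m) * q z"
    "\<And>\<zeta>. cmod \<zeta> = R \<Longrightarrow> G \<zeta> = \<zeta> ^ m * g (z + \<zeta> *s 1)"
    using conj_poly_circle[OF assms(1) R'] R(2) by force
  have "norm (G 0) \<le> 0"
  proof (rule maximum_modulus_frontier[of G "ball 0 R"])
    show "G holomorphic_on interior (ball 0 R)"
      using G(1) by (simp add: holomorphic_on_subset)
    show "continuous_on (closure (ball 0 R)) G"
      using G(1) R(2) by (simp add: holomorphic_on_imp_continuous_on)
    show "norm (G \<zeta>) \<le> 0" if "\<zeta> \<in> frontier (ball 0 R)" for \<zeta>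
      using that R(2) by (simp add: G(3) assms(3) R')
  qed (use R in auto)
  then show ?thesis using G(2) R(2) by simp
qed

section \<open>Polynomials along real lines\<close>

lemma pderiv_surj: "\<exists>P. pderiv P = (Q :: 'a :: field_char_0 poly)"
proof (intro exI)
  have "pderiv (\<Sum>i\<le>degree Q. monom (coeff Q i / of_nat (Suc i)) (Suc i)) =
      (\<Sum>i\<le>degree Q. monom (coeff Q i) i)"
    by (subst sum_comp_morphism[of pderiv, symmetric])
       (simp_all add: pderiv_add pderiv_monom o_def del: of_nat_Suc)
  then show "pderiv (\<Sum>i\<le>degree Q. monom (coeff Q i / of_nat (Suc i)) (Suc i)) = Q"
    by (simp only: poly_as_sum_of_monoms)
qed

text \<open>
  Integrate one derivative at a time: \<open>\<phi> 0\<close> differs by a constant from a polynomial antiderivative of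
  \<open>\<phi> 1\<close>.
\<close>

lemma polynomial_if_iterated_derivative_zero:
  fixes \<phi> :: "nat \<Rightarrow> real \<Rightarrow> complex"
  assumes "\<And>i x. (\<phi> i has_vector_derivative \<phi> (Suc i) x) (at x)" "\<And>x. \<phi> N x = 0"
  shows "\<exists>P. \<forall>x. \<phi> 0 x = poly P (of_real x)"
  using assms
proof (induction N arbitrary: \<phi>)
  case 0
  then show ?case by (intro exI[of _ 0]) simp
next
  case (Suc N)
  obtain Q where Q: "\<And>x. \<phi> 1 x = poly Q (of_real x)"
    using Suc.IH[of "\<lambda>i. \<phi> (Suc i)"] Suc.prems by auto
  obtain P where P: "pderiv P = Q" using pderiv_surj by blast
  have "((\<lambda>x. \<phi> 0 x - poly P (of_real x)) has_vector_derivative 0) (at x)" for x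
  proof -
    have "((\<lambda>x. poly P (of_real x)) has_vector_derivative poly Q (of_real x)) (at x)"
      using has_vector_derivative_real_field[OF poly_DERIV[of P]] by (simp add: P)
    from has_vector_derivative_diff[OF Suc.prems(1)[of 0 x] this] show ?thesis
      by (simp add: Q[symmetric])
  qed
  then obtain c where "\<And>x. \<phi> 0 x - poly P (of_real x) = c"
    using has_vector_derivative_zero_constant[of UNIV "\<lambda>x. \<phi> 0 x - poly P (of_real x)"] by auto
  then show ?case
    by (intro exI[of _ "P + [:c:]"]) (auto simp: algebra_simps)
qed

lemma poly_tendsto_0_imp_zero:
  fixes P :: "complex poly"
  assumes "(\<lambda>k. poly P (of_nat k)) \<longlonglongrightarrow> 0"
  shows "P = 0"
proof (cases P)
  case (pCons a p)
  have "p = 0"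
  proof (rule ccontr)
    assume "p \<noteq> 0"
    then obtain r where r: "\<And>z. r \<le> norm z \<Longrightarrow> 1 \<le> norm (poly P z)"
      using poly_infinity[of p 1 a] pCons by blast
    have "eventually (\<lambda>k. norm (poly P (of_nat k)) < 1) sequentially"
      using order_tendstoD(2)[OF tendsto_norm[OF assms]] by simp
    moreover have "eventually (\<lambda>k. r \<le> norm (of_nat k :: complex)) sequentially"
      using filterlim_real_sequentially by (simp add: filterlim_at_top)
    ultimately have "eventually (\<lambda>k :: nat. False) sequentially"
      by eventually_elim (meson r linorder_not_less)
    then show False by simp
  qed
  with assms pCons show ?thesis by (simp add: LIMSEQ_const_iff)
qed

lemma line_holomorphic_polynomial_on_real_line:
  assumes f: "line_holomorphic_on f S" and S: "open S"
    and zero: "\<And>w. w \<in> S \<Longrightarrow> (wirtinger j ^^ N) f w = 0"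
    and line: "\<And>x::real. z + axis j (of_real x) \<in> S"
  shows "\<exists>P. \<forall>x::real. f (z + axis j (of_real x)) = poly P (of_real x)"
proof -
  define \<phi> where "\<phi> = (\<lambda>i (x::real). (wirtinger j ^^ i) f (z + axis j (of_real x)))"
  have "((\<lambda>x::real. (wirtinger j ^^ i) f (z + axis j (of_real x))) has_vector_derivative
      (wirtinger j ^^ Suc i) f (z + axis j (of_real x))) (at x)" for i x
  proof -
    have h: "line_holomorphic_on ((wirtinger j ^^ i) f) S"
      by (rule line_holomorphic_on_wirtinger_funpow[OF f S])
    have x: "z + complex_of_real x *s axis j 1 \<in> S"
      using line[of x] by (simp flip: axis_eq_scalar_mult)
    from has_vector_derivative_real_field[OF line_holomorphic_has_field_derivative[OF h x]]
    show ?thesis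
      by (simp add: wirtinger_line_holomorphic[OF h line] flip: axis_eq_scalar_mult)
  qed
  then have "(\<phi> i has_vector_derivative \<phi> (Suc i) x) (at x)" for i x
    by (simp add: \<phi>_def)
  moreover have "\<phi> N x = 0" for x
    using zero line by (simp add: \<phi>_def)
  ultimately show ?thesis
    using polynomial_if_iterated_derivative_zero[of \<phi> N] by (simp add: \<phi>_def)
qed

section \<open>Integrability along translates\<close>

text \<open>
  The translates of \<open>A\<close> by multiples of \<open>c\<close> are disjoint, so the integrals of \<open>F\<close> over them have a finite
  sum.  Moving all of them back to \<open>A\<close> shows that \<open>\<Sum>k. F (z + k c)\<close> is integrable over \<open>A\<close>; it therefore
  converges almost everywhere, and its terms tend to \<open>0\<close>.
\<close>

lemma AE_translates_tendsto_0:
  fixes F :: "'a::euclidean_space \<Rightarrow> real"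
  assumes F: "F \<in> borel_measurable borel" "\<And>z. 0 \<le> F z" "(\<integral>\<^sup>+ z. ennreal (F z) \<partial>lborel) < \<infinity>"
    and A: "A \<in> sets borel" "\<And>z k::nat. z \<in> A \<Longrightarrow> z + real k *\<^sub>R c \<in> A \<Longrightarrow> k = 0"
  shows "AE z in lborel. z \<in> A \<longrightarrow> (\<lambda>k. F (z + real k *\<^sub>R c)) \<longlonglongrightarrow> 0"
proof -
  \<comment> \<open>The translate of \<open>A\<close> by \<open>k c\<close>.\<close>
  define B where "B = (\<lambda>k::nat. {z. z - real k *\<^sub>R c \<in> A})"
  have [measurable]: "A \<in> sets borel" "F \<in> borel_measurable borel" by (fact A F)+
  have [measurable]: "B k \<in> sets borel" for k unfolding B_def by measurable
  have not_less: "\<not> j < k" if "z \<in> B j" "z \<in> B k" for j k z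
  proof
    assume "j < k"
    then have "z - real j *\<^sub>R c = (z - real k *\<^sub>R c) + real (k - j) *\<^sub>R c"
      by (simp add: of_nat_diff algebra_simps)
    with that A(2)[of "z - real k *\<^sub>R c" "k - j"] \<open>j < k\<close> show False by (simp add: B_def)
  qed
  then have disj: "disjoint_family B"
    unfolding disjoint_family_on_def by (metis disjoint_iff linorder_neq_iff)
  have "(\<integral>\<^sup>+ z. (\<Sum>k. indicator A z * ennreal (F (z + real k *\<^sub>R c))) \<partial>lborel) =
      (\<Sum>k. \<integral>\<^sup>+ z. indicator A z * ennreal (F (z + real k *\<^sub>R c)) \<partial>lborel)"
    by (intro nn_integral_suminf) measurable
  also have "\<dots> = (\<Sum>k. \<integral>\<^sup>+ z. indicator (B k) z * ennreal (F z) \<partial>lborel)"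
  proof (intro suminf_cong)
    fix k
    have "(\<integral>\<^sup>+ z. indicator (B k) z * ennreal (F z) \<partial>lborel) =
        (\<integral>\<^sup>+ z. indicator (B k) z * ennreal (F z) \<partial>distr lborel borel ((+) (real k *\<^sub>R c)))"
      by (simp add: lborel_distr_plus)
    also have "\<dots> = (\<integral>\<^sup>+ z. indicator A z * ennreal (F (z + real k *\<^sub>R c)) \<partial>lborel)"
      by (subst nn_integral_distr) (auto simp: B_def indicator_def add.commute)
    finally show "(\<integral>\<^sup>+ z. indicator A z * ennreal (F (z + real k *\<^sub>R c)) \<partial>lborel) =
        (\<integral>\<^sup>+ z. indicator (B k) z * ennreal (F z) \<partial>lborel)" ..
  qed
  also have "\<dots> = (\<integral>\<^sup>+ z. (\<Sum>k. indicator (B k) z * ennreal (F z)) \<partial>lborel)"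
    by (intro nn_integral_suminf[symmetric]) measurable
  also have "\<dots> \<le> (\<integral>\<^sup>+ z. ennreal (F z) \<partial>lborel)"
  proof (rule nn_integral_mono)
    fix z
    show "(\<Sum>k. indicator (B k) z * ennreal (F z)) \<le> ennreal (F z)"
      unfolding ennreal_suminf_multc suminf_indicator[OF disj]
      by (cases "z \<in> (\<Union>k. B k)") simp_all
  qed
  also have "\<dots> < \<infinity>" by (rule F)
  finally have "(\<integral>\<^sup>+ z. (\<Sum>k. indicator A z * ennreal (F (z + real k *\<^sub>R c))) \<partial>lborel) \<noteq> \<infinity>"
    by (rule less_imp_neq)
  moreover have "(\<lambda>z. \<Sum>k. indicator A z * ennreal (F (z + real k *\<^sub>R c))) \<in> borel_measurable lborel"
    by measurable
  ultimately have "AE z in lborel. (\<Sum>k. indicator A z * ennreal (F (z + real k *\<^sub>R c))) \<noteq> \<infinity>"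
    by (intro nn_integral_noteq_infinite)
  then show ?thesis
  proof eventually_elim
    case (elim z)
    show ?case
    proof
      assume "z \<in> A"
      with elim have "(\<Sum>k. ennreal (F (z + real k *\<^sub>R c))) \<noteq> top" by simp
      then have "summable (\<lambda>k. F (z + real k *\<^sub>R c))"
        using F(2) by (intro summable_suminf_not_top) auto
      then show "(\<lambda>k. F (z + real k *\<^sub>R c)) \<longlonglongrightarrow> 0"
        by (rule summable_LIMSEQ_zero)
    qed
  qed
qed

text \<open>
  The set where \<open>f\<close> does not vanish is open and null, and nonempty open sets are not null.
\<close>

lemma continuous_AE_zero_imp_zero:
  fixes f :: "'a::euclidean_space \<Rightarrow> 'b::real_normed_vector"
  assumes S: "open S" and f: "continuous_on S f"
    and AE: "AE z in lborel. z \<in> S \<longrightarrow> f z = 0" and z: "z \<in> S"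
  shows "f z = 0"
proof (rule ccontr)
  assume "f z \<noteq> 0"
  define T where "T = S \<inter> f -` (- {0})"
  have T: "open T" unfolding T_def by (rule continuous_open_preimage[OF f S]) auto
  have "T \<in> null_sets lborel"
    using AE AE_iff_null_sets[of T lborel] T by (auto simp: T_def elim: eventually_mono)
  then have "negligible T"
    unfolding negligible_iff_null_sets by (rule null_sets_completionI)
  moreover have "z \<in> T" using z \<open>f z \<noteq> 0\<close> by (simp add: T_def)
  ultimately show False using open_not_negligible[OF T] by blast
qed

section \<open>The Siegel upper half-space\<close>

lemma siegel_rho_translate [simp]:
  "siegel_rho (z + axis last_index (of_real x)) = siegel_rho z"
proof -
  have "(\<Sum>j\<in>UNIV - {last_index}. (cmod ((z + axis last_index (of_real x)) $ j))\<^sup>2) =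
      (\<Sum>j\<in>UNIV - {last_index}. (cmod (z $ j))\<^sup>2)"
    by (intro sum.cong) (auto simp: axis_def)
  then show ?thesis by (simp add: siegel_rho_def)
qed

lemma siegel_iff: "z \<in> siegel \<longleftrightarrow> 0 < siegel_rho z"
  by (simp add: siegel_def siegel_rho_def)

lemma continuous_on_siegel_rho: "continuous_on S siegel_rho"
  unfolding siegel_rho_def by (intro continuous_intros)

lemma siegel_eq: "siegel = {z. 0 < siegel_rho z}"
  by (auto simp: siegel_iff)

lemma open_siegel: "open siegel"
  unfolding siegel_eq by (intro open_Collect_less continuous_on_siegel_rho continuous_on_const)

theorem theorem1p1:
  fixes f :: "complex ^ 'n::{finite,linorder} \<Rightarrow> complex"
    and p t :: real
    and \<alpha> :: "'n \<Rightarrow> nat"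
  assumes "1 \<le> p" and "t > -1"
    and "f \<in> weighted_bergman p t"
    and "\<forall>z\<in>siegel. siegel_L_pow \<alpha> f z = 0"
  shows "\<forall>z\<in>siegel. f z = 0"
proof
  fix z0 :: "complex ^ 'n::{finite,linorder}" assume z0: "z0 \<in> siegel"
  have hol: "line_holomorphic_on f siegel"
    using assms(3) by (simp add: weighted_bergman_def holomorphic_vec_imp_line_holomorphic)
  then have cont: "continuous_on siegel f" by (simp add: line_holomorphic_on_def)
  obtain m c N where "c \<noteq> 0" and
    top: "conj_poly siegel m (siegel_L_pow \<alpha> f) (\<lambda>z. c * (wirtinger last_index ^^ N) f z)"
    using conj_poly_siegel_L_pow[OF hol open_siegel, of \<alpha>] by (elim exE conjE) (rule that)
  have "(wirtinger last_index ^^ N) f z = 0" if "z \<in> siegel" for z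
    using conj_poly_zero_imp_top_zero[OF top open_siegel _ that] assms(4) \<open>c \<noteq> 0\<close> by simp
  then have poly: "\<exists>P. \<forall>x::real. f (z + axis last_index (of_real x)) = poly P (of_real x)"
    if "z \<in> siegel" for z
    using that by (intro line_holomorphic_polynomial_on_real_line[OF hol open_siegel]) (auto simp: siegel_iff)

  define F where "F = (\<lambda>z. indicator siegel z *\<^sub>R (cmod (f z) powr p * siegel_rho z powr t))"
  have F_meas: "F \<in> borel_measurable borel"
    unfolding F_def
  proof (rule borel_measurable_continuous_on_indicator)
    show "continuous_on siegel (\<lambda>z. cmod (f z) powr p * siegel_rho z powr t)"
      using assms(1)
      by (intro continuous_intros continuous_on_powr' cont continuous_on_siegel_rho) (auto simp: siegel_iff)
  qed (simp add: open_siegel)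
  have "(\<integral>\<^sup>+ z. ennreal (F z) \<partial>lborel) = (\<integral>\<^sup>+ z. ennreal (F z) \<partial>lebesgue)"
    by (rule nn_integral_completion[symmetric])
  also have "\<dots> = (\<integral>\<^sup>+ z. ennreal (cmod (f z) powr p * siegel_rho z powr t) \<partial>lebesgue_on siegel)"
    using borel_open[OF open_siegel]
    by (subst nn_integral_restrict_space)
       (auto simp: F_def indicator_def sets_completionI_sets intro!: nn_integral_cong)
  also have "\<dots> < \<infinity>"
    using assms(3) by (simp add: weighted_bergman_def weighted_Lp_def)
  finally have F_int: "(\<integral>\<^sup>+ z. ennreal (F z) \<partial>lborel) < \<infinity>" .

  \<comment> \<open>An open slab of width \<open>1\<close> is disjoint from its translates by positive integers, and it contains
    the given point \<open>z0\<close>.\<close>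
  define A :: "(complex ^ 'n::{finite,linorder}) set"
    where "A = {z. \<bar>Re (z $ last_index) - Re (z0 $ last_index)\<bar> < 1 / 2}"
  have A: "open A" unfolding A_def by (intro open_Collect_less continuous_intros)
  have scale: "x *\<^sub>R axis last_index 1 = (axis last_index (of_real x) :: complex ^ 'n::{finite,linorder})" for x
    by (simp add: vec_eq_iff axis_def of_real_def)
  have "AE z in lborel. z \<in> A \<longrightarrow> (\<lambda>k. F (z + real k *\<^sub>R axis last_index 1)) \<longlonglongrightarrow> 0"
  proof (rule AE_translates_tendsto_0[OF F_meas _ F_int])
    show "k = 0" if "z \<in> A" "z + real k *\<^sub>R axis last_index 1 \<in> A" for z and k :: nat
    proof -
      have "real k < 1"
        using that unfolding scale A_def mem_Collect_eq
        by (simp only: vector_add_component axis_nth plus_complex.sel Re_complex_of_real)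
      then show ?thesis by simp
    qed
  qed (use A in \<open>auto simp: F_def\<close>)
  then have "AE z in lborel. z \<in> A \<inter> siegel \<longrightarrow> f z = 0"
  proof eventually_elim
    case (elim z)
    show ?case
    proof
      assume z: "z \<in> A \<inter> siegel"
      define g where "g = (\<lambda>k::nat. f (z + axis last_index (of_nat k)))"
      have rho: "siegel_rho z > 0" using z by (simp add: siegel_iff)
      have "F (z + axis last_index (of_nat k)) = cmod (g k) powr p * siegel_rho z powr t" for k :: nat
        using rho siegel_rho_translate[of z "real k"] by (simp add: F_def g_def siegel_iff indicator_def)
      then have "(\<lambda>k. cmod (g k) powr p * siegel_rho z powr t) \<longlonglongrightarrow> 0"
        using elim z by (simp add: scale)
      from tendsto_divide[OF this tendsto_const[of "siegel_rho z powr t"]]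
      have "(\<lambda>k. cmod (g k) powr p) \<longlonglongrightarrow> 0" using rho by simp
      then have "(\<lambda>k. (cmod (g k) powr p) powr (1 / p)) \<longlonglongrightarrow> 0 powr (1 / p)"
        using assms(1) by (intro tendsto_powr') auto
      then have g: "g \<longlonglongrightarrow> 0"
        using assms(1) by (simp add: powr_powr tendsto_norm_zero_iff)
      obtain P where P: "\<And>x::real. f (z + axis last_index (of_real x)) = poly P (of_real x)"
        using poly z by blast
      have "g = (\<lambda>k. poly P (of_nat k))"
        using P[of "real _"] by (simp add: g_def fun_eq_iff)
      with g have "P = 0" using poly_tendsto_0_imp_zero by simp
      then show "f z = 0" using P[of 0] by (simp add: axis_zero)
    qed
  qed
  moreover have "z0 \<in> A \<inter> siegel" using z0 by (simp add: A_def)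
  ultimately show "f z0 = 0"
    using continuous_AE_zero_imp_zero[of "A \<inter> siegel" f] A open_siegel cont
    by (meson continuous_on_subset inf_le2 open_Int)
qed

end
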